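(* Let $n\ge 2$ and $k\in\{n-1,n\}$, and let $M_k$ be a matching of $k$ edges in the complete graph $K_{2n}$. Then $\chi'_L(K_{2n}\setminus M_k)=2n$.
   Context: $K_{2n}\setminus M_k$ denotes the graph obtained from $K_{2n}$ by deleting the edges of $M_k$. For a proper edge coloring $c:E(G)\to\{1,\dots,k\}$ of a connected graph $G$, let $\pi=(\mathcal{C}_1,\dots,\mathcal{C}_k)$ be the ordered partition of $E(G)$ into color classes. For a vertex $v$ and an edge $e=xy$, $d(v,e)=\min\{d(v,x),d(v,y)\}$, and $d(v,\mathcal{C}_i)=\min\{d(v,e): e\in\mathcal{C}_i\}$. The edge color code of $v$ is $c_\pi(v)=(d(v,\mathcal{C}_1),\dots,d(v,\mathcal{C}_k))$. The coloring is an edge-locating coloring if distinct vertices have distinct edge color codes; $\chi'_L(G)$ is the minimum number of colors in an edge-locating coloring of $G$. *)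

theory Defs
  imports Main "HOL-Library.FuncSet" "HOL-Library.Extended_Nat"
begin

type_synonym 'a graph = "'a set \<times> 'a set set"

abbreviation verts :: "'a graph \<Rightarrow> 'a set" where
  "verts \<equiv> fst"

abbreviation edges :: "'a graph \<Rightarrow> 'a set set" where
  "edges \<equiv> snd"

definition complete_graph :: "'a set \<Rightarrow> 'a graph" where
  "complete_graph V = (V, {e. e \<subseteq> V \<and> card e = 2})"

definition delete_edges :: "'a graph \<Rightarrow> 'a set set \<Rightarrow> 'a graph" where
  "delete_edges G M = (verts G, edges G - M)"

definition matching :: "'a graph \<Rightarrow> 'a set set \<Rightarrow> bool" where
  "matching G M \<longleftrightarrow> M \<subseteq> edges G \<and> pairwise disjnt M"

definition walk :: "'a graph \<Rightarrow> 'a list \<Rightarrow> bool" where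
  "walk G p \<longleftrightarrow> p \<noteq> [] \<and> set p \<subseteq> verts G \<and> successively (\<lambda>x y. {x, y} \<in> edges G) p"

text \<open>Distances take values in \<^typ>\<open>enat\<close>, where the infimum of a nonempty set is its minimum and
  the infimum of the empty set is \<open>\<infinity>\<close>. A walk with \<open>m\<close> vertices has length \<open>m - 1\<close>.\<close>

definition vertex_dist :: "'a graph \<Rightarrow> 'a \<Rightarrow> 'a \<Rightarrow> enat" where
  "vertex_dist G u v =
     (INF p\<in>{p. walk G p \<and> hd p = u \<and> last p = v}. enat (length p - 1))"

definition edge_dist :: "'a graph \<Rightarrow> 'a \<Rightarrow> 'a set \<Rightarrow> enat" where
  "edge_dist G v e = (INF x\<in>e. vertex_dist G v x)"

definition class_dist :: "'a graph \<Rightarrow> 'a \<Rightarrow> 'a set set \<Rightarrow> enat" where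
  "class_dist G v C = (INF e\<in>C. edge_dist G v e)"

definition proper_edge_coloring :: "'a graph \<Rightarrow> nat \<Rightarrow> ('a set \<Rightarrow> nat) \<Rightarrow> bool" where
  "proper_edge_coloring G k c \<longleftrightarrow>
     c \<in> edges G \<rightarrow> {1..k} \<and>
     (\<forall>e\<in>edges G. \<forall>f\<in>edges G. e \<noteq> f \<and> e \<inter> f \<noteq> {} \<longrightarrow> c e \<noteq> c f)"

definition color_class :: "'a graph \<Rightarrow> ('a set \<Rightarrow> nat) \<Rightarrow> nat \<Rightarrow> 'a set set" where
  "color_class G c i = {e \<in> edges G. c e = i}"

definition edge_color_code :: "'a graph \<Rightarrow> nat \<Rightarrow> ('a set \<Rightarrow> nat) \<Rightarrow> 'a \<Rightarrow> enat list" where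
  "edge_color_code G k c v = map (\<lambda>i. class_dist G v (color_class G c i)) [1..<Suc k]"

text \<open>Colors need not all be used: an unused color contributes the entry \<open>\<infinity>\<close> to every code, so it
  separates no vertices and does not affect the minimum number of colors.\<close>

definition edge_locating_coloring :: "'a graph \<Rightarrow> nat \<Rightarrow> ('a set \<Rightarrow> nat) \<Rightarrow> bool" where
  "edge_locating_coloring G k c \<longleftrightarrow>
     proper_edge_coloring G k c \<and> inj_on (edge_color_code G k c) (verts G)"

text \<open>The value is \<open>\<infinity>\<close> if there is no edge-locating coloring, as for a single edge.\<close>

definition edge_locating_chromatic_number :: "'a graph \<Rightarrow> enat" where
  "edge_locating_chromatic_number G = (INF k\<in>{k. \<exists>c. edge_locating_coloring G k c}. enat k)"

end

theory Submission
  imports Defs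
begin

text \<open>Every vertex is adjacent to an endpoint of every edge that avoids it, so all entries of a code are
  \<open>0\<close>, \<open>1\<close>, or \<open>\<infinity>\<close> for an unused color, and a coloring is edge-locating iff the sets of colors
  at the vertices (the palettes) are distinct. Fewer than \<open>2n\<close> colors fail by counting: for \<open>k = n\<close>,
  a set of \<open>2n - 1\<close> colors has only \<open>2n - 1\<close> subsets of size \<open>2n - 2\<close>, and for \<open>k = n - 1\<close> the
  two unmatched vertices both see all \<open>2n - 1\<close> colors.

  For the upper bound, identify \<open>V\<close> with the integers modulo \<open>2n\<close> and give \<open>{x, y}\<close> the color
  \<open>x + y\<close>. Then \<open>x\<close> misses exactly \<open>2x\<close> and, if \<open>{x, x'} \<in> M\<close>, also \<open>x + x'\<close>. If all matching
  edges have an odd sum, then only antipodal vertices \<open>x\<close> and \<open>x + n\<close> can have the same palette, and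
  only if their matching edges have equal sums. The labelling is chosen to exclude this. It exists
  unless \<open>n = k = 2\<close>, when the graph is a 4-cycle, all of whose edges can be colored differently.\<close>

section \<open>Edge color codes and palettes\<close>

definition palette :: "'a graph \<Rightarrow> ('a set \<Rightarrow> nat) \<Rightarrow> 'a \<Rightarrow> nat set" where
  "palette G c v = c ` {e \<in> edges G. v \<in> e}"

text \<open>An infimum below 1 is witnessed by a member below 1, and in \<open>enat\<close> only 0
  is below 1. For empty \<open>S\<close> the infimum is \<infinity> and both sides are
  false.\<close>

lemma INF_enat_eq_0_iff: "(INF x\<in>S. f x) = (0::enat) \<longleftrightarrow> (\<exists>x\<in>S. f x = 0)"
proof -
  have "(INF x\<in>S. f x) < 1 \<longleftrightarrow> (\<exists>x\<in>S. f x < 1)"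
    by (rule INF_less_iff)
  then show ?thesis
    by (simp add: one_eSuc)
qed

lemma vertex_dist_eq_0_iff:
  assumes "u \<in> verts G"
  shows "vertex_dist G u v = 0 \<longleftrightarrow> u = v"
proof
  assume "vertex_dist G u v = 0"
  then obtain p where "walk G p" "hd p = u" "last p = v" "enat (length p - 1) = 0"
    unfolding vertex_dist_def INF_enat_eq_0_iff by auto
  then show "u = v"
    by (cases p) (auto simp: zero_enat_def walk_def)
next
  assume "u = v"
  with assms have "walk G [u] \<and> hd [u] = u \<and> last [u] = v"
    by (simp add: walk_def)
  then show "vertex_dist G u v = 0"
    unfolding vertex_dist_def INF_enat_eq_0_iff
    by (intro bexI[of _ "[u]"]) (auto simp: zero_enat_def)
qed

lemma vertex_dist_le_1:
  assumes "{u, v} \<in> edges G" "u \<in> verts G" "v \<in> verts G"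
  shows "vertex_dist G u v \<le> 1"
proof -
  have "walk G [u, v] \<and> hd [u, v] = u \<and> last [u, v] = v"
    using assms by (simp add: walk_def)
  then have "vertex_dist G u v \<le> enat (length [u, v] - 1)"
    unfolding vertex_dist_def by (intro INF_lower) blast
  then show ?thesis
    by (simp add: one_enat_def)
qed

lemma class_dist_eq_0_iff:
  assumes "v \<in> verts G"
  shows "class_dist G v (color_class G c i) = 0 \<longleftrightarrow> i \<in> palette G c v"
  unfolding class_dist_def edge_dist_def INF_enat_eq_0_iff vertex_dist_eq_0_iff[OF assms]
  by (auto simp: color_class_def palette_def)

lemma class_dist_le_1:
  assumes "v \<in> verts G" "\<Union>(edges G) \<subseteq> verts G"
    and near: "\<And>e. e \<in> edges G \<Longrightarrow> v \<in> e \<or> (\<exists>x\<in>e. {v, x} \<in> edges G)"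
    and e: "e \<in> edges G" "c e = i"
  shows "class_dist G v (color_class G c i) \<le> 1"
proof -
  obtain x where x: "x \<in> e" "vertex_dist G v x \<le> 1"
  proof (cases "v \<in> e")
    case True
    then show ?thesis
      using that[of v] vertex_dist_eq_0_iff[OF assms(1), of v] by simp
  next
    case False
    then obtain x where "x \<in> e" "{v, x} \<in> edges G"
      using near[OF e(1)] by blast
    then show ?thesis
      using that[of x] vertex_dist_le_1[of v x G] assms(1,2) e(1) by blast
  qed
  have "class_dist G v (color_class G c i) \<le> edge_dist G v e"
    unfolding class_dist_def using e by (intro INF_lower) (simp add: color_class_def)
  also have "\<dots> \<le> vertex_dist G v x"
    unfolding edge_dist_def using x by (intro INF_lower)
  finally show ?thesis
    using x(2) by simp
qed

lemma palette_subset: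
  assumes "proper_edge_coloring G q c"
  shows "palette G c v \<subseteq> {1..q}"
  using assms by (auto simp: palette_def proper_edge_coloring_def Pi_iff)

text \<open>Edges at \<open>v\<close> meet pairwise in \<open>v\<close>, so a proper coloring is
  injective on them and the size of a palette is the degree.\<close>

lemma card_palette:
  assumes "proper_edge_coloring G q c"
  shows "card (palette G c v) = card {e \<in> edges G. v \<in> e}"
  unfolding palette_def
proof (rule card_image, rule inj_onI)
  fix e f
  assume "e \<in> {e \<in> edges G. v \<in> e}" "f \<in> {e \<in> edges G. v \<in> e}" "c e = c f"
  moreover from this have "e \<inter> f \<noteq> {}"
    by blast
  ultimately show "e = f"
    using assms unfolding proper_edge_coloring_def by (metis (no_types, lifting) mem_Collect_eq)
qed

text \<open>The zero entries of a code are exactly the colors of the palette, so equal codes force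
  equal palettes.\<close>

lemma edge_locating_coloring_if_inj_palette:
  assumes proper: "proper_edge_coloring G q c" and inj: "inj_on (palette G c) (verts G)"
  shows "edge_locating_coloring G q c"
  unfolding edge_locating_coloring_def
proof (intro conjI proper inj_onI)
  fix x y
  assume x: "x \<in> verts G" and y: "y \<in> verts G"
    and "edge_color_code G q c x = edge_color_code G q c y"
  then have "class_dist G x (color_class G c i) = class_dist G y (color_class G c i)"
    if "i \<in> {1..q}" for i
    using that by (cases "i = q") (auto simp: edge_color_code_def)
  then have "i \<in> palette G c x \<longleftrightarrow> i \<in> palette G c y" if "i \<in> {1..q}" for i
    using that class_dist_eq_0_iff[OF x, of c i] class_dist_eq_0_iff[OF y, of c i] by simp
  then have "palette G c x = palette G c y"
    using palette_subset[OF proper, of x] palette_subset[OF proper, of y] by blast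
  then show "x = y"
    using inj x y by (auto dest: inj_onD)
qed

text \<open>Under \<open>near\<close> an entry depends on the vertex only through membership of the
  color in the palette: 0 inside, otherwise 1, or \<infinity> at every vertex alike if the class is
  empty. Equal palettes therefore give equal codes.\<close>

lemma inj_palette_if_edge_locating_coloring:
  assumes loc: "edge_locating_coloring G q c"
    and wf: "\<Union>(edges G) \<subseteq> verts G"
    and near: "\<And>v e. v \<in> verts G \<Longrightarrow> e \<in> edges G \<Longrightarrow> v \<in> e \<or> (\<exists>x\<in>e. {v, x} \<in> edges G)"
  shows "inj_on (palette G c) (verts G)"
proof (rule inj_onI)
  fix x y
  assume x: "x \<in> verts G" and y: "y \<in> verts G" and eq: "palette G c x = palette G c y"
  have code: "class_dist G v (color_class G c i) =
      (if i \<in> palette G c v then 0 else if color_class G c i = {} then \<infinity> else 1)"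
    if v: "v \<in> verts G" for v i
  proof (cases "i \<in> palette G c v \<or> color_class G c i = {}")
    case True
    then show ?thesis
      using class_dist_eq_0_iff[OF v, of c i] by (auto simp: class_dist_def top_enat_def)
  next
    case False
    then obtain e where "e \<in> edges G" "c e = i"
      by (auto simp: color_class_def)
    then have "class_dist G v (color_class G c i) \<le> 1"
      using class_dist_le_1[OF v wf near[OF v]] by blast
    moreover have "class_dist G v (color_class G c i) \<noteq> 0"
      using class_dist_eq_0_iff[OF v, of c i] False by blast
    ultimately have "class_dist G v (color_class G c i) = 1"
      by (metis ileI1 one_eSuc order.antisym zero_less_iff_neq_zero)
    then show ?thesis
      using False by simp
  qed
  have "edge_color_code G q c x = edge_color_code G q c y"
    unfolding edge_color_code_def code[OF x] code[OF y] eq ..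
  then show "x = y"
    using loc x y unfolding edge_locating_coloring_def by (auto dest: inj_onD)
qed

section \<open>Complete graphs without a matching\<close>

lemma pairwise_disjnt_eq:
  assumes "pairwise disjnt M" "e \<in> M" "f \<in> M" "x \<in> e" "x \<in> f"
  shows "e = f"
  using assms by (auto simp: pairwise_def disjnt_iff)

lemma edge_complete_minus_iff:
  "{x, y} \<in> edges (delete_edges (complete_graph V) M) \<longleftrightarrow>
    x \<in> V \<and> y \<in> V \<and> x \<noteq> y \<and> {x, y} \<notin> M"
  by (auto simp: delete_edges_def complete_graph_def card_2_iff doubleton_eq_iff)

lemma edge_complete_minusE:
  assumes "e \<in> edges (delete_edges (complete_graph V) M)" "x \<in> e"
  obtains y where "e = {x, y}" "x \<in> V" "y \<in> V" "x \<noteq> y" "{x, y} \<notin> M"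
proof -
  from assms have "card e = 2" "e \<subseteq> V" "e \<notin> M"
    by (auto simp: delete_edges_def complete_graph_def)
  moreover obtain y where "e = {x, y}" "x \<noteq> y"
    using \<open>card e = 2\<close> assms(2) unfolding card_2_iff by auto
  ultimately show thesis
    using that by auto
qed

lemma palette_complete_minus:
  assumes "v \<in> V"
  shows "palette (delete_edges (complete_graph V) M) c v =
    {c {v, w} |w. w \<in> V \<and> w \<noteq> v \<and> {v, w} \<notin> M}"
proof -
  have "{e \<in> edges (delete_edges (complete_graph V) M). v \<in> e} =
      {{v, w} |w. w \<in> V \<and> w \<noteq> v \<and> {v, w} \<notin> M}"
    using assms by (auto simp: edge_complete_minus_iff elim: edge_complete_minusE)
  then show ?thesis
    unfolding palette_def by auto
qed

text \<open>A matching removes at most one edge at \<open>v\<close>, so of the two edges from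
  \<open>v\<close> to the endpoints of \<open>e\<close> at least one survives.\<close>

lemma edge_complete_minus_near:
  assumes "matching (complete_graph V) M" "v \<in> V"
    and e: "e \<in> edges (delete_edges (complete_graph V) M)"
  shows "v \<in> e \<or> (\<exists>x\<in>e. {v, x} \<in> edges (delete_edges (complete_graph V) M))"
proof (cases "v \<in> e")
  case False
  have "card e = 2"
    using e by (auto simp: delete_edges_def complete_graph_def)
  then obtain x y where xy: "e = {x, y}" "x \<noteq> y"
    unfolding card_2_iff by blast
  then have "x \<in> V" "y \<in> V"
    using e edge_complete_minus_iff by metis+
  moreover have "{v, x} \<notin> M \<or> {v, y} \<notin> M"
    using pairwise_disjnt_eq[of M "{v, x}" "{v, y}" v] assms(1) xy(2)
    by (auto simp: matching_def doubleton_eq_iff)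
  ultimately show ?thesis
    using False xy assms(2) by (auto simp: edge_complete_minus_iff)
qed simp

lemma degree_complete_minus:
  assumes "matching (complete_graph V) M" "finite V" "v \<in> V"
  shows "card {e \<in> edges (delete_edges (complete_graph V) M). v \<in> e} =
    (if v \<in> \<Union>M then card V - 2 else card V - 1)"
proof -
  have "{e \<in> edges (delete_edges (complete_graph V) M). v \<in> e} =
      (\<lambda>w. {v, w}) ` {w \<in> V. w \<noteq> v \<and> {v, w} \<notin> M}"
    using assms by (auto simp: edge_complete_minus_iff elim: edge_complete_minusE)
  moreover have "inj_on (\<lambda>w. {v, w}) A" for A
    by (auto simp: inj_on_def doubleton_eq_iff)
  ultimately have card: "card {e \<in> edges (delete_edges (complete_graph V) M). v \<in> e} =
      card {w \<in> V. w \<noteq> v \<and> {v, w} \<notin> M}"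
    by (simp add: card_image)
  show ?thesis
  proof (cases "v \<in> \<Union>M")
    case True
    then obtain e where e: "e \<in> M" "v \<in> e"
      by blast
    then have "card e = 2" "e \<subseteq> V"
      using assms(1) by (auto simp: matching_def complete_graph_def)
    then obtain w where w: "e = {v, w}" "w \<noteq> v" "w \<in> V"
      using e(2) unfolding card_2_iff by auto
    have "{v, u} \<in> M \<longleftrightarrow> u = w" for u
      using pairwise_disjnt_eq[of M "{v, u}" "{v, w}" v] assms(1) e(1) w(1)
      by (auto simp: matching_def doubleton_eq_iff)
    then have "{w \<in> V. w \<noteq> v \<and> {v, w} \<notin> M} = V - {v, w}"
      by auto
    moreover have "card (V - {v, w}) = card V - card {v, w}"
      using assms(2,3) w(3) by (intro card_Diff_subset) auto
    ultimately show ?thesis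
      using True card w(2) by simp
  next
    case False
    then have "{w \<in> V. w \<noteq> v \<and> {v, w} \<notin> M} = V - {v}"
      by auto
    then show ?thesis
      using False card assms(2,3) by simp
  qed
qed

lemma card_Union_matching:
  assumes "matching (complete_graph V) M" "finite V"
  shows "\<Union>M \<subseteq> V" "card (\<Union>M) = 2 * card M" "finite M"
proof -
  have M: "M \<subseteq> Pow V" "\<And>e. e \<in> M \<Longrightarrow> card e = 2" "pairwise disjnt M"
    using assms(1) by (auto simp: matching_def complete_graph_def)
  then show "\<Union>M \<subseteq> V" "finite M"
    using assms(2) finite_subset[of M "Pow V"] by auto
  have "card (\<Union>M) = sum card M"
    using M by (intro card_Union_disjoint) (auto intro: card_ge_0_finite)
  then show "card (\<Union>M) = 2 * card M"
    using M(2) by simp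
qed

section \<open>The lower bound: counting palettes with fewer than \<open>2 * n\<close>
  colors\<close>

lemma colors_ge_if_edge_locating:
  assumes "n \<ge> 2" "k \<in> {n - 1, n}" "finite V" "card V = 2 * n"
    and M: "matching (complete_graph V) M" "card M = k"
    and loc: "edge_locating_coloring (delete_edges (complete_graph V) M) q c"
  shows "2 * n \<le> q"
proof (rule ccontr)
  assume "\<not> 2 * n \<le> q"
  define G where "G = delete_edges (complete_graph V) M"
  have verts: "verts G = V"
    by (simp add: G_def delete_edges_def complete_graph_def)
  have proper: "proper_edge_coloring G q c"
    using loc by (simp add: G_def edge_locating_coloring_def)
  have "\<Union>(edges G) \<subseteq> verts G"
    by (auto simp: G_def delete_edges_def complete_graph_def)
  then have inj: "inj_on (palette G c) V"
    using inj_palette_if_edge_locating_coloring[of G q c] loc edge_complete_minus_near[OF M(1)]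
    unfolding verts[symmetric] by (simp add: G_def delete_edges_def complete_graph_def)
  \<comment> \<open>Allowing all \<open>2 * n - 1\<close> colors, even if \<open>q\<close> is
    smaller, makes \<open>C\<close> the only possible palette at a vertex of degree
    \<open>2 * n - 1\<close>.\<close>
  define C where "C = {1..2 * n - 1}"
  have C: "palette G c v \<subseteq> C" for v
    using palette_subset[OF proper, of v] \<open>\<not> 2 * n \<le> q\<close> by (force simp: C_def)
  have card: "card (palette G c v) = (if v \<in> \<Union>M then 2 * n - 2 else 2 * n - 1)" if "v \<in> V" for v
    using degree_complete_minus[OF M(1) assms(3) that] assms(4) card_palette[OF proper]
    by (simp add: G_def)
  have full: "palette G c v = C" if "v \<in> V" "v \<notin> \<Union>M" for v
    using card[OF that(1)] that(2) C[of v] by (intro card_subset_eq) (auto simp: C_def)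
  have UM: "\<Union>M \<subseteq> V" "card (\<Union>M) = 2 * k"
    using card_Union_matching[OF M(1) assms(3)] M(2) by auto
  show False
  proof (cases "k = n")
    case True
    then have "\<Union>M = V"
      using UM assms(3,4) by (intro card_subset_eq) auto
    then have "palette G c ` V \<subseteq> {B. B \<subseteq> C \<and> card B = 2 * n - 2}"
      using card C by auto
    moreover have "finite {B. B \<subseteq> C \<and> card B = 2 * n - 2}"
      by (simp add: C_def)
    ultimately have "card (palette G c ` V) \<le> card {B. B \<subseteq> C \<and> card B = 2 * n - 2}"
      by (intro card_mono)
    also have "\<dots> = (2 * n - 1) choose (2 * n - 2)"
      by (subst n_subsets) (auto simp: C_def)
    also have "\<dots> = 2 * n - 1"
    proof -
      have "2 * n - 1 = Suc (2 * n - 2)"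
        using assms(1) by simp
      then show ?thesis
        by (metis binomial_Suc_n)
    qed
    finally show False
      using card_image[OF inj] assms(1,4) by simp
  next
    case False
    then have "card (V - \<Union>M) = 2"
      using UM assms by (subst card_Diff_subset) (auto intro: finite_subset)
    then obtain u v where "V - \<Union>M = {u, v}" "u \<noteq> v"
      unfolding card_2_iff by blast
    then have "u \<in> V" "u \<notin> \<Union>M" "v \<in> V" "v \<notin> \<Union>M"
      by blast+
    then show False
      using full[of u] full[of v] inj \<open>u \<noteq> v\<close> by (auto dest: inj_onD)
  qed
qed

section \<open>The sum coloring\<close>

text \<open>Both quotients by \<open>m\<close> are 0 or 1, so congruent numbers are at most one
  multiple of \<open>m\<close> apart.\<close>

lemma mod_eq_cases:
  fixes a b m :: nat
  assumes "a mod m = b mod m" "a < 2 * m" "b < 2 * m"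
  shows "a = b \<or> a = b + m \<or> b = a + m"
  using assms by (auto simp: mod_if split: if_splits)

text \<open>Summing over the edge as a set makes the value independent of the order of the
  endpoints; \<open>Suc\<close> shifts the residues from \<open>0\<close> to
  \<open>2 * n - 1\<close> into the color range \<open>{1..2 * n}\<close>.\<close>

definition sum_color :: "nat \<Rightarrow> ('a \<Rightarrow> nat) \<Rightarrow> 'a set \<Rightarrow> nat" where
  "sum_color n f e = Suc ((\<Sum>x\<in>e. f x) mod (2 * n))"

lemma sum_color_pair: "x \<noteq> y \<Longrightarrow> sum_color n f {x, y} = Suc ((f x + f y) mod (2 * n))"
  by (simp add: sum_color_def)

lemma mod_add_left_inj:
  fixes a b c m :: nat
  assumes "(a + b) mod m = (a + c) mod m" "b < m" "c < m"
  shows "b = c"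
proof -
  have "b mod m = c mod m"
    using assms(1) by (simp add: nat_mod_eq_iff add.assoc)
  then show ?thesis
    using assms(2,3) by simp
qed

text \<open>If two edges at \<open>x\<close> have equal colors, cancelling \<open>f x\<close> leaves
  equal labels at their other ends, and \<open>f\<close> is injective.\<close>

lemma proper_sum_color:
  assumes "n \<ge> 1" and f: "bij_betw f V {0..<2 * n}"
  shows "proper_edge_coloring (delete_edges (complete_graph V) M) (2 * n) (sum_color n f)"
  unfolding proper_edge_coloring_def
proof (intro conjI ballI impI)
  show "sum_color n f \<in> edges (delete_edges (complete_graph V) M) \<rightarrow> {1..2 * n}"
    using assms(1) by (auto simp: sum_color_def Suc_le_eq)
next
  let ?E = "edges (delete_edges (complete_graph V) M)"
  fix e e' assume e: "e \<in> ?E" "e' \<in> ?E" "e \<noteq> e' \<and> e \<inter> e' \<noteq> {}"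
  then obtain x where x: "x \<in> e" "x \<in> e'"
    by blast
  obtain y where y: "e = {x, y}" "x \<noteq> y" "y \<in> V"
    using edge_complete_minusE[OF e(1) x(1)] by blast
  obtain z where z: "e' = {x, z}" "x \<noteq> z" "z \<in> V"
    using edge_complete_minusE[OF e(2) x(2)] by blast
  have "f y < 2 * n" "f z < 2 * n"
    using f y z by (auto dest: bij_betwE)
  moreover have "f y \<noteq> f z"
    using e(3) y z f by (auto simp: bij_betw_def dest: inj_onD)
  ultimately show "sum_color n f e \<noteq> sum_color n f e'"
    using mod_add_left_inj[of "f x" "f y" "2 * n" "f z"] y z by (auto simp: sum_color_pair)
qed

text \<open>Exactly one \<open>z\<close> in \<open>V\<close> solves \<open>f x + f z = r\<close>
  modulo \<open>2 * n\<close>. The color is missing at \<open>x\<close> precisely when this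
  \<open>z\<close> is not a neighbor of \<open>x\<close>: it is \<open>x\<close> itself, or it is
  joined to \<open>x\<close> by a deleted edge.\<close>

lemma not_in_palette_sum_color_iff:
  assumes "n \<ge> 1" and f: "bij_betw f V {0..<2 * n}" and M: "M \<subseteq> edges (complete_graph V)"
    and x: "x \<in> V"
  shows "Suc (r mod (2 * n)) \<notin> palette (delete_edges (complete_graph V) M) (sum_color n f) x \<longleftrightarrow>
    r mod (2 * n) = (2 * f x) mod (2 * n) \<or>
    (\<exists>y. {x, y} \<in> M \<and> r mod (2 * n) = (f x + f y) mod (2 * n))"
proof -
  let ?m = "2 * n"
  let ?pal = "palette (delete_edges (complete_graph V) M) (sum_color n f) x"
  have pal: "Suc (r mod ?m) \<in> ?pal \<longleftrightarrow>
      (\<exists>w\<in>V. w \<noteq> x \<and> {x, w} \<notin> M \<and> r mod ?m = (f x + f w) mod ?m)"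
    unfolding palette_complete_minus[OF x] by (auto simp: sum_color_pair[of x] cong: conj_cong)
      (metis sum_color_pair)
  have lt: "f v < ?m" if "v \<in> V" for v
    using f that by (auto dest: bij_betwE)
  have uniq: "v = w" if "v \<in> V" "w \<in> V" "(f x + f v) mod ?m = (f x + f w) mod ?m" for v w
    using mod_add_left_inj[OF that(3)] lt that f by (auto simp: bij_betw_def dest: inj_onD)
  obtain z where z: "z \<in> V" "r mod ?m = (f x + f z) mod ?m"
  proof -
    \<comment> \<open>This is the residue of \<open>r - f x\<close>, written so that subtraction on
      naturals does not truncate.\<close>
    have "(r + (?m - f x)) mod ?m \<in> f ` V"
      using f assms(1) by (simp add: bij_betw_def)
    then obtain z where "z \<in> V" "f z = (r + (?m - f x)) mod ?m"
      by auto
    moreover from this have "(f x + f z) mod ?m = (f x + (r + (?m - f x))) mod ?m"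
      by (simp add: mod_add_right_eq)
    moreover have "f x + (r + (?m - f x)) = r + ?m"
      using lt[OF x] by simp
    ultimately show ?thesis
      using that by simp
  qed
  have M': "y \<in> V \<and> y \<noteq> x" if "{x, y} \<in> M" for y
    using M that by (auto simp: complete_graph_def card_2_iff doubleton_eq_iff)
  show ?thesis
    unfolding pal using z uniq x M' by (auto simp: mult_2) metis+
qed

text \<open>Parity survives reduction modulo the even number \<open>2 * n\<close>. By
  \<open>odd\<close>, the only even sum missing at \<open>x\<close> is thus \<open>2 * f x\<close>,
  and equal palettes leave only equal or antipodal labels. The conditions \<open>saturated\<close>
  and \<open>unsaturated\<close> exclude the antipodal ones.\<close>

lemma edge_locating_sum_color:
  assumes n: "n \<ge> 1" and f: "bij_betw f V {0..<2 * n}" and M: "M \<subseteq> edges (complete_graph V)"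
    and odd: "\<And>x y. {x, y} \<in> M \<Longrightarrow> odd (f x + f y)"
    and saturated: "\<And>x x' y y'. {x, x'} \<in> M \<Longrightarrow> {y, y'} \<in> M \<Longrightarrow> f y = f x + n \<Longrightarrow>
      (f x + f x') mod (2 * n) \<noteq> (f y + f y') mod (2 * n)"
    and unsaturated: "\<And>x y. x \<in> V - \<Union>M \<Longrightarrow> y \<in> V - \<Union>M \<Longrightarrow> f y \<noteq> f x + n"
  shows "edge_locating_coloring (delete_edges (complete_graph V) M) (2 * n) (sum_color n f)"
proof (rule edge_locating_coloring_if_inj_palette[OF proper_sum_color[OF n f]], rule inj_onI)
  define pal where "pal = palette (delete_edges (complete_graph V) M) (sum_color n f)"
  fix x y
  assume xV: "x \<in> verts (delete_edges (complete_graph V) M)"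
    and yV: "y \<in> verts (delete_edges (complete_graph V) M)"
    and eq: "palette (delete_edges (complete_graph V) M) (sum_color n f) x =
      palette (delete_edges (complete_graph V) M) (sum_color n f) y"
  from xV yV have x: "x \<in> V" and y: "y \<in> V"
    by (simp_all add: delete_edges_def complete_graph_def)
  note iff = not_in_palette_sum_color_iff[OF n f M]
  have par: "a mod (2 * n) \<noteq> b mod (2 * n)" if "odd a" "even b" for a b
    using that by (metis dvd_mod_iff dvd_triv_left)
  have "Suc (2 * f x mod (2 * n)) \<notin> palette (delete_edges (complete_graph V) M) (sum_color n f) x"
    using iff[OF x] by blast
  then have dbl: "2 * f x mod (2 * n) = 2 * f y mod (2 * n)"
    unfolding eq using iff[OF y, of "2 * f x"] par odd by (metis dvd_triv_left)
  have lt: "f x < 2 * n" "f y < 2 * n"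
    using f x y by (auto dest: bij_betwE)
  \<comment> \<open>Cancelling the factor 2 turns the congruence modulo \<open>2 * n\<close> into
    one modulo \<open>n\<close>, between labels below \<open>2 * n\<close>.\<close>
  have "f x = f y \<or> f x = f y + n \<or> f y = f x + n"
    using dbl lt mod_eq_cases[of "f x" n "f y"] by (simp add: mult_mod_right[symmetric])
  moreover have False
    if z: "z \<in> V" "w \<in> V" "f w = f z + n"
      and e: "palette (delete_edges (complete_graph V) M) (sum_color n f) z =
        palette (delete_edges (complete_graph V) M) (sum_color n f) w" for z w
  proof -
    \<comment> \<open>The color of a deleted edge at \<open>a\<close> is also missing at
      \<open>b\<close>. Its sum is odd, so it is not \<open>2 * f b\<close> and must come from a
      deleted edge at \<open>b\<close>. Hence a saturated and an unsaturated vertex never share a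
      palette.\<close>
    have sat: "\<exists>b'. {b, b'} \<in> M \<and> (f a + f a') mod (2 * n) = (f b + f b') mod (2 * n)"
      if "{a, a'} \<in> M" "a \<in> V" "b \<in> V"
        and "palette (delete_edges (complete_graph V) M) (sum_color n f) a =
        palette (delete_edges (complete_graph V) M) (sum_color n f) b" for a a' b
      using iff[OF that(2), of "f a + f a'"] iff[OF that(3), of "f a + f a'"] that(1,4)
        par[OF odd[OF that(1)], of "2 * f b"] by auto
    have partner: "\<exists>v'. {v, v'} \<in> M" if v: "v \<in> \<Union>M" for v
    proof -
      obtain e where "e \<in> M" "v \<in> e"
        using v by blast
      moreover from this have "card e = 2"
        using M by (auto simp: complete_graph_def)
      ultimately show ?thesis
        unfolding card_2_iff by (metis insert_commute insert_iff singletonD)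
    qed
    show False
    proof (cases "z \<in> \<Union>M \<or> w \<in> \<Union>M")
      case True
      then show False
        using partner sat[OF _ z(1,2) e] sat[OF _ z(2,1) e[symmetric]] saturated[OF _ _ z(3)]
        by metis
    next
      case False
      then show False
        using unsaturated z by blast
    qed
  qed
  ultimately show "x = y"
    using x y eq f by (metis bij_betw_def inj_onD)
qed

section \<open>Labellings adapted to the matching\<close>

text \<open>Pairs are sent to pairs one at a time: a bijection from the new \<open>e\<close> onto
  any \<open>d\<close> in \<open>P\<close> is glued to the map for the rest, and disjointness on
  both sides makes the result a bijection.\<close>

lemma ex_bij_pairs:
  assumes "finite M" "finite P" "card M = card P" "pairwise disjnt M" "pairwise disjnt P"
    and "\<forall>e\<in>M. card e = 2" "\<forall>e\<in>P. card e = 2"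
  shows "\<exists>f. bij_betw f (\<Union>M) (\<Union>P) \<and> (\<forall>e\<in>M. f ` e \<in> P)"
  using assms
proof (induction M arbitrary: P rule: finite_induct)
  case empty
  then show ?case
    by (simp add: bij_betw_def)
next
  case (insert e M)
  then have "card P = Suc (card M)"
    by simp
  then obtain d where d: "d \<in> P"
    by (metis card.empty ex_in_conv nat.distinct(1))
  let ?P = "P - {d}"
  have "\<exists>f. bij_betw f (\<Union>M) (\<Union>?P) \<and> (\<forall>e\<in>M. f ` e \<in> ?P)"
  proof (rule insert.IH)
    show "card M = card ?P"
      using \<open>card P = Suc (card M)\<close> d insert.prems(1) by simp
  qed (use insert.prems in \<open>auto simp: pairwise_insert intro: pairwise_subset\<close>)
  then obtain f where f: "bij_betw f (\<Union>M) (\<Union>?P)" "\<forall>e\<in>M. f ` e \<in> ?P"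
    by blast
  have "finite e" "finite d" "card e = card d"
    using insert.prems d by (auto intro: card_ge_0_finite)
  then obtain g where g: "bij_betw g e d"
    using finite_same_card_bij by blast
  have disj: "e \<inter> \<Union>M = {}"
    using insert.prems insert.hyps by (auto simp: pairwise_insert disjnt_iff)
  have disj': "d \<inter> \<Union>?P = {}"
    using insert.prems d by (auto simp: pairwise_def disjnt_iff)
  define h where "h = (\<lambda>x. if x \<in> e then g x else f x)"
  have h1: "bij_betw h e d"
    using g by (rule bij_betw_cong[THEN iffD1, rotated]) (simp add: h_def)
  have h2: "bij_betw h (\<Union>M) (\<Union>?P)"
    using f(1) by (rule bij_betw_cong[THEN iffD1, rotated]) (use disj in \<open>auto simp: h_def\<close>)
  have "bij_betw h (e \<union> \<Union>M) (d \<union> \<Union>?P)"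
    using h1 h2 disj' by (rule bij_betw_combine)
  then have "bij_betw h (\<Union>(insert e M)) (\<Union>(insert d ?P))"
    unfolding Union_insert .
  then have "bij_betw h (\<Union>(insert e M)) (\<Union>P)"
    unfolding insert_Diff[OF d] .
  moreover have "h ` e' \<in> P" if "e' \<in> M" for e'
  proof -
    have "h ` e' = f ` e'"
      using disj that by (intro image_cong) (auto simp: h_def)
    then show ?thesis
      using f(2) that by simp
  qed
  moreover have "h ` e = d"
    using h1 by (simp add: bij_betw_def)
  ultimately have "bij_betw h (\<Union>(insert e M)) (\<Union>P) \<and> (\<forall>e'\<in>insert e M. h ` e' \<in> P)"
    using d by simp
  then show ?case
    by blast
qed

text \<open>The map \<open>\<tau>\<close> encodes a perfect matching of the labels that joins each
  even \<open>2 * t\<close> to an odd label, so all sums are odd; \<open>M\<close> is carried onto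
  it. Which end of an edge gets the even label is left open, hence the equation between
  sets.\<close>

lemma perfect_matching_labelling:
  fixes \<tau> :: "nat \<Rightarrow> nat"
  assumes "finite M" "card M = n" "pairwise disjnt M" "\<forall>e\<in>M. card e = 2" "\<Union>M = V"
    and \<tau>: "bij_betw \<tau> {..<n} {i. i < 2 * n \<and> odd i}"
  obtains f where "bij_betw f V {0..<2 * n}"
    and "\<And>x y. {x, y} \<in> M \<Longrightarrow> \<exists>t<n. {f x, f y} = {2 * t, \<tau> t}"
proof -
  define P where "P = (\<lambda>t. {2 * t, \<tau> t}) ` {..<n}"
  have odd: "odd (\<tau> t)" if "t < n" for t
    using bij_betwE[OF \<tau>] that by auto
  have inj: "inj_on (\<lambda>t. {2 * t, \<tau> t}) {..<n}"
  proof (rule inj_onI)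
    fix t u assume "t \<in> {..<n}" "u \<in> {..<n}" "{2 * t, \<tau> t} = {2 * u, \<tau> u}"
    then show "t = u"
      using odd[of t] odd[of u] by (auto simp: doubleton_eq_iff)
  qed
  have ne: "2 * t \<noteq> \<tau> u" if "u < n" for t u
    using odd[OF that] by (metis dvd_triv_left)
  have "disjnt {2 * t, \<tau> t} {2 * u, \<tau> u}" if "t < n" "u < n" "t \<noteq> u" for t u
  proof -
    have "\<tau> t \<noteq> \<tau> u"
      using \<tau> that by (auto simp: bij_betw_def dest: inj_onD)
    then show ?thesis
      using that(3) ne[OF that(1), of u] ne[OF that(2), of t] by (simp add: disjnt_def)
  qed
  then have "pairwise disjnt P"
    unfolding P_def by (intro pairwise_imageI) auto
  moreover have "\<forall>e\<in>P. card e = 2"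
    using ne by (auto simp: P_def)
  moreover have "\<Union>P = {0..<2 * n}"
  proof -
    have "\<Union>P = (*) 2 ` {..<n} \<union> \<tau> ` {..<n}"
      by (auto simp: P_def)
    also have "(*) 2 ` {..<n} = {i. i < 2 * n \<and> even i}"
      by (auto elim!: evenE)
    also have "\<tau> ` {..<n} = {i. i < 2 * n \<and> odd i}"
      using \<tau> by (simp add: bij_betw_def)
    also have "{i. i < 2 * n \<and> even i} \<union> {i. i < 2 * n \<and> odd i} = {0..<2 * n}"
      by auto
    finally show ?thesis .
  qed
  moreover have "finite P" "card P = n"
    using inj by (auto simp: P_def card_image)
  ultimately obtain f where f: "bij_betw f V {0..<2 * n}" "\<forall>e\<in>M. f ` e \<in> P"
    using ex_bij_pairs[of M P] assms by auto
  show thesis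
  proof (rule that[OF f(1)])
    fix x y assume "{x, y} \<in> M"
    then have "{f x, f y} \<in> P"
      using f(2) by fastforce
    then show "\<exists>t<n. {f x, f y} = {2 * t, \<tau> t}"
      by (auto simp: P_def)
  qed
qed

text \<open>There are exactly \<open>n\<close> odd numbers below \<open>2 * n\<close>, so
  injectivity suffices.\<close>

lemma bij_betw_odd_if_inj:
  fixes \<tau> :: "nat \<Rightarrow> nat"
  assumes "inj_on \<tau> {..<n}" "\<And>t. t < n \<Longrightarrow> \<tau> t < 2 * n \<and> odd (\<tau> t)"
  shows "bij_betw \<tau> {..<n} {i. i < 2 * n \<and> odd i}"
proof -
  have "{i. i < 2 * n \<and> odd i} = (\<lambda>t. 2 * t + 1) ` {..<n}"
    by (auto elim!: oddE)
  then have "card {i. i < 2 * n \<and> odd i} = n"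
    by (simp add: card_image inj_on_def)
  moreover have "\<tau> ` {..<n} \<subseteq> {i. i < 2 * n \<and> odd i}"
    using assms(2) by auto
  ultimately have "\<tau> ` {..<n} = {i. i < 2 * n \<and> odd i}"
    using card_image[OF assms(1)] by (intro card_subset_eq) auto
  then show ?thesis
    using assms(1) by (simp add: bij_betw_def)
qed

text \<open>For \<open>k = n - 1\<close> the two unmatched vertices are joined by an extra pair, so
  that labels can be handed out pairwise. The last conclusion recovers this pair and is vacuous for
  \<open>k = n\<close>.\<close>

lemma ex_perfect_matching:
  assumes "k \<in> {n - 1, n}" "n \<ge> 1" "finite V" "card V = 2 * n"
    and M: "matching (complete_graph V) M" "card M = k"
  obtains N where "M \<subseteq> N" "matching (complete_graph V) N" "card N = n" "\<Union>N = V"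
    and "\<And>x y. x \<in> V - \<Union>M \<Longrightarrow> y \<in> V - \<Union>M \<Longrightarrow> x \<noteq> y \<Longrightarrow> {x, y} \<in> N"
proof (cases "k = n")
  case True
  then have "\<Union>M = V"
    using card_Union_matching[OF M(1) assms(3)] M(2) assms(3,4) by (intro card_subset_eq) auto
  then show ?thesis
    using that[of M] M True by auto
next
  case False
  note UM = card_Union_matching[OF M(1) assms(3)]
  have "card (V - \<Union>M) = 2"
    using UM M(2) False assms by (subst card_Diff_subset) (auto intro: finite_subset)
  then obtain u v where uv: "V - \<Union>M = {u, v}" "u \<noteq> v"
    unfolding card_2_iff by blast
  then have V: "V = \<Union>M \<union> {u, v}" "u \<notin> \<Union>M" "v \<notin> \<Union>M"
    using UM(1) by blast+
  show ?thesis
  proof (rule that[of "insert {u, v} M"])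
    show "matching (complete_graph V) (insert {u, v} M)"
      using M(1) V uv by (auto simp: matching_def complete_graph_def pairwise_insert disjnt_iff)
    show "card (insert {u, v} M) = n"
      using V(2) UM(3) M(2) False assms(1,2) by (subst card_insert_disjoint) auto
  qed (use V uv in auto)
qed

section \<open>Coloring with \<open>2n\<close> colors\<close>

text \<open>When all edges have different colors, a palette determines the edges at its vertex.
  Distinct vertices share at most the edge between them, but each vertex here has degree 2.\<close>

lemma edge_locating_cycle4:
  assumes "finite V" "card V = 4" "matching (complete_graph V) M" "card M = 2"
  shows "\<exists>c. edge_locating_coloring (delete_edges (complete_graph V) M) 4 c"
proof -
  let ?G = "delete_edges (complete_graph V) M"
  have "card {e. e \<subseteq> V \<and> card e = 2} = 6"
    using assms(1,2) by (simp add: n_subsets) (simp add: numeral_eq_Suc)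
  moreover have "M \<subseteq> {e. e \<subseteq> V \<and> card e = 2}"
    using assms(3) by (simp add: matching_def complete_graph_def)
  ultimately have E: "card (edges ?G) = 4" "finite (edges ?G)"
    using assms(1,4) card_Union_matching(3)[OF assms(3,1)]
    by (auto simp: delete_edges_def complete_graph_def card_Diff_subset)
  then obtain c where c: "bij_betw c (edges ?G) {1..4::nat}"
    using finite_same_card_bij[of "edges ?G" "{1..4::nat}"] by auto
  have proper: "proper_edge_coloring ?G 4 c"
    using c by (auto simp: proper_edge_coloring_def bij_betw_def dest: inj_onD)
  have "inj_on (palette ?G c) (verts ?G)"
  proof (rule inj_onI, rule ccontr)
    fix x y
    assume xy: "x \<in> verts ?G" "y \<in> verts ?G" "palette ?G c x = palette ?G c y" "x \<noteq> y"
    then have V: "x \<in> V" "y \<in> V"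
      by (simp_all add: delete_edges_def complete_graph_def)
    have "card {e \<in> edges ?G. x \<in> e} \<ge> 2"
      using degree_complete_minus[OF assms(3,1) V(1)] assms(2) by simp
    then have "\<not> {e \<in> edges ?G. x \<in> e} \<subseteq> {{x, y}}"
      using card_mono[of "{{x, y}}" "{e \<in> edges ?G. x \<in> e}"] by auto
    then obtain e where e: "e \<in> edges ?G" "x \<in> e" "e \<noteq> {x, y}"
      by blast
    then have "c e \<in> palette ?G c y"
      unfolding xy(3)[symmetric] by (auto simp: palette_def)
    then obtain e' where "e' \<in> edges ?G" "y \<in> e'" "c e' = c e"
      by (auto simp: palette_def)
    then have "y \<in> e"
      using c e(1) by (metis bij_betw_def inj_onD)
    then show False
      using e xy(4) by (auto elim!: edge_complete_minusE)
  qed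
  then show ?thesis
    using edge_locating_coloring_if_inj_palette[OF proper] by blast
qed

lemma ex_edge_locating_coloring:
  assumes "n \<ge> 2" "k \<in> {n - 1, n}" "finite V" "card V = 2 * n"
    and M: "matching (complete_graph V) M" "card M = k"
  shows "\<exists>c. edge_locating_coloring (delete_edges (complete_graph V) M) (2 * n) c"
proof -
  obtain N where N: "M \<subseteq> N" "matching (complete_graph V) N" "card N = n" "\<Union>N = V"
    and rest: "\<And>x y. x \<in> V - \<Union>M \<Longrightarrow> y \<in> V - \<Union>M \<Longrightarrow> x \<noteq> y \<Longrightarrow> {x, y} \<in> N"
    using ex_perfect_matching[OF assms(2) _ assms(3,4) M] assms(1) by auto
  have N': "finite N" "pairwise disjnt N" "\<forall>e\<in>N. card e = 2"
    using card_Union_matching(3)[OF N(2) assms(3)] N(2)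
    by (auto simp: matching_def complete_graph_def)
  have ME: "M \<subseteq> edges (complete_graph V)"
    using M(1) by (simp add: matching_def)
  \<comment> \<open>What remains is arithmetic on \<open>\<tau>\<close>. By \<open>gap\<close> no
    pair contains antipodal labels, which settles the two unmatched vertices and the two ends of one
    edge of \<open>M\<close>. By \<open>sep\<close> antipodal labels in different pairs have
    different pair sums; for \<open>k = 1\<close> there is only one edge in \<open>M\<close>, so
    nothing is to be compared.\<close>
  have main: "\<exists>c. edge_locating_coloring (delete_edges (complete_graph V) M) (2 * n) c"
    if \<tau>: "inj_on \<tau> {..<n}" "\<And>t. t < n \<Longrightarrow> \<tau> t < 2 * n \<and> odd (\<tau> t)"
      and gap: "\<And>t a. t < n \<Longrightarrow> a \<in> {2 * t, \<tau> t} \<Longrightarrow> a + n \<notin> {2 * t, \<tau> t}"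
      and sep: "\<And>t u a. t < n \<Longrightarrow> u < n \<Longrightarrow> t \<noteq> u \<Longrightarrow> k \<noteq> 1 \<Longrightarrow> a \<in> {2 * t, \<tau> t} \<Longrightarrow>
        a + n \<in> {2 * u, \<tau> u} \<Longrightarrow> (2 * t + \<tau> t) mod (2 * n) \<noteq> (2 * u + \<tau> u) mod (2 * n)"
    for \<tau> :: "nat \<Rightarrow> nat"
  proof -
    obtain f where f: "bij_betw f V {0..<2 * n}"
      and fN: "\<And>x y. {x, y} \<in> N \<Longrightarrow> \<exists>t<n. {f x, f y} = {2 * t, \<tau> t}"
      using perfect_matching_labelling[OF N'(1) N(3) N'(2,3) N(4) bij_betw_odd_if_inj[OF \<tau>]]
      by blast
    have sum: "f x + f y = 2 * t + \<tau> t" if "{f x, f y} = {2 * t, \<tau> t}" for x y t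
      using that by (auto simp: doubleton_eq_iff)
    have "edge_locating_coloring (delete_edges (complete_graph V) M) (2 * n) (sum_color n f)"
    proof (rule edge_locating_sum_color[OF _ f ME])
      fix x y assume "{x, y} \<in> M"
      then obtain t where "t < n" "{f x, f y} = {2 * t, \<tau> t}"
        using fN N(1) by blast
      then show "odd (f x + f y)"
        using sum[of x y t] \<tau>(2)[of t] by simp
    next
      fix x x' y y'
      assume xx: "{x, x'} \<in> M" and yy: "{y, y'} \<in> M" and fy: "f y = f x + n"
      obtain t where t: "t < n" "{f x, f x'} = {2 * t, \<tau> t}"
        using xx fN N(1) by blast
      obtain u where u: "u < n" "{f y, f y'} = {2 * u, \<tau> u}"
        using yy fN N(1) by blast
      have a: "f x \<in> {2 * t, \<tau> t}" "f x + n \<in> {2 * u, \<tau> u}"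
        unfolding t(2)[symmetric] u(2)[symmetric] fy[symmetric] by simp_all
      then have "t \<noteq> u"
        using gap[OF t(1)] by blast
      moreover have "k \<noteq> 1"
      proof
        assume "k = 1"
        then have "{x, x'} = {y, y'}"
          using xx yy M(2) by (metis card_1_singletonE singletonD)
        then have "{f x, f x'} = {f y, f y'}"
          by (metis image_empty image_insert)
        then show False
          using gap[OF t(1) a(1)] t(2) u(2) a(2) by simp
      qed
      ultimately show "(f x + f x') mod (2 * n) \<noteq> (f y + f y') mod (2 * n)"
        using sep[OF t(1) u(1)] a sum[OF t(2)] sum[OF u(2)] by simp
    next
      fix x y assume xy: "x \<in> V - \<Union>M" "y \<in> V - \<Union>M"
      show "f y \<noteq> f x + n"
      proof
        assume fy: "f y = f x + n"
        then have "x \<noteq> y"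
          using assms(1) by auto
        then obtain t where t: "t < n" "{f x, f y} = {2 * t, \<tau> t}"
          using rest[OF xy] fN by blast
        then have "f x \<in> {2 * t, \<tau> t}" "f x + n \<in> {2 * t, \<tau> t}"
          unfolding t(2)[symmetric] fy[symmetric] by simp_all
        then show False
          using gap[OF t(1)] by blast
      qed
    qed (use assms(1) in simp)
    then show ?thesis
      by blast
  qed
  \<comment> \<open>The case \<open>n = 2\<close>, \<open>k = 1\<close> joins the odd case because
    \<open>sep\<close> is vacuous for \<open>k = 1\<close>.\<close>
  consider "odd n \<or> n = 2 \<and> k = 1" | "n = 2" "k = 2" | "even n" "n > 2"
    using assms(1,2) by fastforce
  then show ?thesis
  proof cases
    case 1
    \<comment> \<open>Consecutive labels differ by 1, less than \<open>n\<close>, so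
      \<open>gap\<close> holds. The pair sums are \<open>4 * t + 1\<close>, and for odd
      \<open>n\<close> these are distinct modulo \<open>2 * n\<close> when
      \<open>t < n\<close>.\<close>
    show ?thesis
    proof (rule main[of "\<lambda>t. 2 * t + 1"])
      fix t a :: nat
      assume "a \<in> {2 * t, 2 * t + 1}"
      then show "a + n \<notin> {2 * t, 2 * t + 1}"
        using assms(1) by auto
    next
      fix t u a :: nat
      assume h: "t < n" "u < n" "t \<noteq> u" "k \<noteq> 1"
      with 1 obtain m where m: "n = 2 * m + 1"
        by (auto elim!: oddE)
      show "(2 * t + (2 * t + 1)) mod (2 * n) \<noteq> (2 * u + (2 * u + 1)) mod (2 * n)"
      proof
        assume "(2 * t + (2 * t + 1)) mod (2 * n) = (2 * u + (2 * u + 1)) mod (2 * n)"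
        then have "4 * t + 1 = 4 * u + 1 \<or> 4 * t + 1 = 4 * u + 1 + 2 * n \<or>
            4 * u + 1 = 4 * t + 1 + 2 * n"
          by (intro mod_eq_cases) (use h in auto)
        then show False
          using h(3) m by (elim disjE; arith)
      qed
    qed (auto simp: inj_on_def)
  next
    case 2
    then show ?thesis
      using edge_locating_cycle4[OF assms(3) _ M(1)] assms(4) M(2) by simp
  next
    case 3
    then obtain m where m: "n = 2 * m" "m \<ge> 2"
      by (auto elim!: evenE)
    \<comment> \<open>The plain pairing of \<open>2t\<close> with \<open>2t + 1\<close> is invariant under adding the even number \<open>n\<close>, so the
      pairs in the upper half are shifted cyclically by one.\<close>
    define \<tau> where "\<tau> t = (if t < m then 2 * t + 1 else if t = m then 4 * m - 1 else 2 * t - 1)" for t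
    \<comment> \<open>The values are restated with additions, which keeps truncated subtraction away
      from linear arithmetic.\<close>
    have \<tau>: "t < m \<and> \<tau> t = 2 * t + 1 \<or> t = m \<and> \<tau> t + 1 = 4 * m \<or> t > m \<and> \<tau> t + 1 = 2 * t" for t
      using m(2) by (auto simp: \<tau>_def)
    have od: "odd (\<tau> t)" for t
      using m(2) by (auto simp: \<tau>_def)
    have less: "\<tau> t < 2 * n" if "t < n" for t
      using \<tau>[of t] that m by (elim disjE conjE; arith)
    show ?thesis
    proof (rule main[of \<tau>])
      show "inj_on \<tau> {..<n}"
      proof (rule inj_onI)
        fix t u assume "t \<in> {..<n}" "u \<in> {..<n}" "\<tau> t = \<tau> u"
        then have "t < 2 * m" "u < 2 * m" "\<tau> t = \<tau> u"
          using m by auto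
        then show "t = u"
          using \<tau>[of t] \<tau>[of u] by (elim disjE conjE; arith)
      qed
    next
      fix t a assume "t < n" "a \<in> {2 * t, \<tau> t}"
      \<comment> \<open>As \<open>n\<close> is even, \<open>a\<close> and \<open>a + n\<close> have
        the same parity, whereas each pair has one even and one odd label.\<close>
      then show "a + n \<notin> {2 * t, \<tau> t}"
        using od[of t] 3 by (metis add_left_imp_eq dvd_triv_left even_add insert_iff
            less_nat_zero_code singletonD add.right_neutral)
    next
      fix t u a
      assume h: "t < n" "u < n" and a: "a \<in> {2 * t, \<tau> t}" "a + n \<in> {2 * u, \<tau> u}"
      have "even (a + n) \<longleftrightarrow> even a"
        using 3 by simp
      \<comment> \<open>Equal parity means that the antipodal labels are the two even or the two odd
        members of their pairs.\<close>
      then have au: "a = 2 * t \<and> 2 * u = a + n \<or> a = \<tau> t \<and> \<tau> u = a + n"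
        using a od[of t] od[of u] by (metis dvd_triv_left insert_iff singletonD)
      show "(2 * t + \<tau> t) mod (2 * n) \<noteq> (2 * u + \<tau> u) mod (2 * n)"
      proof
        assume "(2 * t + \<tau> t) mod (2 * n) = (2 * u + \<tau> u) mod (2 * n)"
        then have "2 * t + \<tau> t = 2 * u + \<tau> u \<or> 2 * t + \<tau> t = 2 * u + \<tau> u + 2 * n \<or>
            2 * u + \<tau> u = 2 * t + \<tau> t + 2 * n"
          by (rule mod_eq_cases) (use h less[OF h(1)] less[OF h(2)] in auto)
        moreover have "t < 2 * m" "u < 2 * m" "3 \<le> n \<and> n = 2 * m"
          using h m 3 by auto
        \<comment> \<open>The second sum exceeds the first by \<open>4 * m - 2\<close> or
          \<open>4 * m + 2\<close>, and for \<open>u = m\<close>, where the shift wraps around, by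
          \<open>6 * m - 2\<close> or \<open>2 * m + 2\<close>. None of these is 0 or
          \<open>4 * m\<close> when \<open>m \<ge> 2\<close>; for \<open>m = 1\<close> the last two
          would be \<open>4 * m\<close>.\<close>
        ultimately show False
          using au \<tau>[of t] \<tau>[of u] m(2) by (elim disjE conjE; linarith)
      qed
    qed (use od less in auto)
  qed
qed

theorem theorem11:
  fixes n k :: nat and V :: "'a set" and M :: "'a set set"
  assumes "n \<ge> 2"
    and "k \<in> {n - 1, n}"
    and "finite V" and "card V = 2 * n"
    and "matching (complete_graph V) M" and "card M = k"
  shows "edge_locating_chromatic_number (delete_edges (complete_graph V) M) = enat (2 * n)"
proof (rule order.antisym)
  show "edge_locating_chromatic_number (delete_edges (complete_graph V) M) \<le> enat (2 * n)"
    unfolding edge_locating_chromatic_number_def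
    using ex_edge_locating_coloring[OF assms] by (intro INF_lower) simp
  show "enat (2 * n) \<le> edge_locating_chromatic_number (delete_edges (complete_graph V) M)"
    unfolding edge_locating_chromatic_number_def
    using colors_ge_if_edge_locating[OF assms] by (intro INF_greatest) auto
qed

end
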